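(* Let $n,k,r$ be positive integers with $r\geq 2$ and $n\geq rk$. The independence number of $\mathrm{IG}_{n,k}^{(r)}$ is $\binom{n-(r-1)k-1}{k-1}$.
   Context: Write $[n]=\{1,\ldots,n\}$ and view its elements as placed in clockwise order on a circle; a $k$-subset of $[n]$ is called a $k$-polygon. A $k$-polygon $P$ is $r$-stable if the cyclic distance (on $\mathbb{Z}/n\mathbb{Z}$) between any two distinct points of $P$ is at least $r$. Two $k$-polygons $P=\{p_1<\cdots<p_k\}$ and $Q=\{q_1<\cdots<q_k\}$ interlace if either $p_1<q_1<p_2<q_2<\cdots<p_k<q_k$ or $q_1<p_1<q_2<p_2<\cdots<q_k<p_k$. The graph $\mathrm{IG}_{n,k}^{(r)}$ has as vertices the $r$-stable $k$-polygons on $[n]$, two being adjacent iff they interlace. *)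

theory Defs
  imports "HOL-Library.Ramsey"
begin

text \<open>Distance on \<open>\<int>/n\<int>\<close>; it depends only on the residue classes of \<open>a\<close> and \<open>b\<close> modulo \<open>n\<close>.\<close>

definition cyclic_dist :: "nat \<Rightarrow> nat \<Rightarrow> nat \<Rightarrow> int" where
  "cyclic_dist n a b = min ((int a - int b) mod int n) ((int b - int a) mod int n)"

definition polygons :: "nat \<Rightarrow> nat \<Rightarrow> nat set set" where
  "polygons n k = {P. P \<subseteq> {1..n} \<and> card P = k}"

definition stable :: "nat \<Rightarrow> nat \<Rightarrow> nat set \<Rightarrow> bool" where
  "stable n r P \<longleftrightarrow> (\<forall>a\<in>P. \<forall>b\<in>P. a \<noteq> b \<longrightarrow> int r \<le> cyclic_dist n a b)"

text \<open>\<open>alternates k P Q\<close> is the chain \<open>p\<^sub>1 < q\<^sub>1 < p\<^sub>2 < q\<^sub>2 < \<dots> < p\<^sub>k < q\<^sub>k\<close> for the increasing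
  enumerations of the \<open>k\<close>-sets \<open>P\<close> and \<open>Q\<close>, with list indices starting at \<open>0\<close>.\<close>

definition alternates :: "nat \<Rightarrow> nat set \<Rightarrow> nat set \<Rightarrow> bool" where
  "alternates k P Q \<longleftrightarrow>
     (\<forall>i<k. sorted_list_of_set P ! i < sorted_list_of_set Q ! i) \<and>
     (\<forall>i. Suc i < k \<longrightarrow> sorted_list_of_set Q ! i < sorted_list_of_set P ! Suc i)"

definition interlace :: "nat \<Rightarrow> nat set \<Rightarrow> nat set \<Rightarrow> bool" where
  "interlace k P Q \<longleftrightarrow> alternates k P Q \<or> alternates k Q P"

definition IG_verts :: "nat \<Rightarrow> nat \<Rightarrow> nat \<Rightarrow> nat set set" where
  "IG_verts n k r = {P \<in> polygons n k. stable n r P}"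

definition IG_edges :: "nat \<Rightarrow> nat \<Rightarrow> nat \<Rightarrow> nat set set set" where
  "IG_edges n k r = {{P, Q} | P Q. P \<in> IG_verts n k r \<and> Q \<in> IG_verts n k r \<and> interlace k P Q}"

text \<open>Graphs are given by a vertex set and a set of two-element edges, the convention of
  \<^const>\<open>indep\<close>. The maximum is meaningful for finite \<open>V\<close>.\<close>

definition independence_number :: "'a set \<Rightarrow> 'a set set \<Rightarrow> nat" where
  "independence_number V E = Max {card S | S. S \<subseteq> V \<and> indep S E}"

end

theory Submission
  imports Defs
begin

text \<open>
  The polygons through the point \<open>1\<close> form an independent set of the claimed size. For the upper
  bound, contract the edge \<open>{n - 1, n}\<close> of the circle, as in the count of the internal simplices
  of a triangulated cyclic polytope. The polygons that stay stable give an independent family for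
  \<open>(n - 1, k)\<close>. What is lost are the polygons with a gap of exactly \<open>r\<close> across the contracted edge,
  and one polygon of each pair \<open>A \<union> {n - 1}\<close>, \<open>A \<union> {n}\<close>. Restricted to \<open>{1..n - r}\<close>, these lost
  polygons form an independent family for \<open>(n - r, k - 1)\<close>, so Pascal's rule closes an induction.
\<close>

section \<open>Stable polygons\<close>

lemma cyclic_dist_less:
  assumes "1 \<le> a" "a < b" "b \<le> n"
  shows "cyclic_dist n a b = min (int n - (int b - int a)) (int b - int a)"
proof -
  have "(int a - int b) mod int n = (int a - int b + int n) mod int n" by simp
  also have "\<dots> = int a - int b + int n" using assms by (intro mod_pos_pos_trivial) auto
  finally have "(int a - int b) mod int n = int n - (int b - int a)" by simp
  moreover have "(int b - int a) mod int n = int b - int a"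
    using assms by (intro mod_pos_pos_trivial) auto
  ultimately show ?thesis by (simp add: cyclic_dist_def)
qed

lemma cyclic_dist_commute: "cyclic_dist n a b = cyclic_dist n b a"
  by (simp add: cyclic_dist_def min.commute)

text \<open>For \<open>a < b\<close> the two arcs between the points have lengths
  \<open>b - a\<close> and \<open>n - (b - a)\<close>. Both conditions are written additively to
  avoid truncated subtraction.\<close>

lemma stable_iff:
  assumes "P \<subseteq> {1..n}"
  shows "stable n r P \<longleftrightarrow> (\<forall>a\<in>P. \<forall>b\<in>P. a < b \<longrightarrow> a + r \<le> b \<and> b + r \<le> a + n)"
proof -
  have *: "int r \<le> cyclic_dist n a b \<longleftrightarrow> a + r \<le> b \<and> b + r \<le> a + n"
    if "a \<in> P" "b \<in> P" "a < b" for a b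
  proof -
    have "1 \<le> a" "b \<le> n" using that assms by auto
    then show ?thesis using that by (auto simp: cyclic_dist_less)
  qed
  show ?thesis
    unfolding stable_def using * by (metis cyclic_dist_commute nat_neq_iff)
qed

lemma IG_verts_iff:
  "P \<in> IG_verts n k r \<longleftrightarrow> P \<subseteq> {1..n} \<and> card P = k \<and>
     (\<forall>a\<in>P. \<forall>b\<in>P. a < b \<longrightarrow> a + r \<le> b \<and> b + r \<le> a + n)"
  unfolding IG_verts_def polygons_def using stable_iff by auto

lemma finite_IG_verts: "finite (IG_verts n k r)"
  by (rule finite_subset[of _ "Pow {1..n}"]) (use IG_verts_iff in \<open>blast, simp\<close>)

lemma IG_verts_finite: "P \<in> IG_verts n k r \<Longrightarrow> finite P"
  by (auto simp: IG_verts_iff intro: finite_subset)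

text \<open>A packing argument: the blocks \<open>{p..<p + r}\<close> are disjoint and fit into the
  window of length \<open>n\<close> that starts at \<open>Min P\<close>. For \<open>k = 1\<close>
  the claim would fail, since every singleton is stable.\<close>

lemma IG_verts_le:
  assumes "P \<in> IG_verts n k r" "2 \<le> k"
  shows "r * k \<le> n"
proof -
  have P: "card P = k" "\<And>a b. a \<in> P \<Longrightarrow> b \<in> P \<Longrightarrow> a < b \<Longrightarrow> a + r \<le> b \<and> b + r \<le> a + n"
    using assms by (auto simp: IG_verts_iff)
  have fin: "finite P" using assms IG_verts_finite by blast
  have ne: "P \<noteq> {}" using P assms by auto
  define m where "m = Min P"
  have m: "m \<in> P" "\<And>p. p \<in> P \<Longrightarrow> m \<le> p" using fin ne by (auto simp: m_def)
  obtain q where q: "q \<in> P" "q \<noteq> m"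
    using P(1) assms(2) m(1) card_le_Suc0_iff_eq[OF fin] by (metis not_less_eq_eq numeral_2_eq_2)
  \<comment> \<open>At \<open>p = m\<close> this says \<open>r \<le> n\<close>, which follows from
    the two arcs between \<open>m\<close> and a second point \<open>q\<close>.\<close>
  have up: "p + r \<le> m + n" if "p \<in> P" for p
  proof (cases "p = m")
    case True
    have "m < q" using q m(2)[of q] by simp
    then show ?thesis using True P(2)[OF m(1) q(1)] by simp
  next
    case False
    then show ?thesis using P(2)[OF m(1) that] m(2)[OF that] by simp
  qed
  have "card (\<Union>p\<in>P. {p..<p + r}) = (\<Sum>p\<in>P. card {p..<p + r})"
  proof (rule card_UN_disjoint[OF fin])
    show "\<forall>a\<in>P. \<forall>b\<in>P. a \<noteq> b \<longrightarrow> {a..<a + r} \<inter> {b..<b + r} = {}"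
    proof (intro ballI impI)
      fix a b assume ab: "a \<in> P" "b \<in> P" "a \<noteq> b"
      have "a + r \<le> b \<or> b + r \<le> a"
        using P(2)[of a b] P(2)[of b a] ab by (cases "a < b") auto
      then show "{a..<a + r} \<inter> {b..<b + r} = {}" by auto
    qed
  qed auto
  also have "\<dots> = r * k" using P(1) by simp
  finally have "r * k = card (\<Union>p\<in>P. {p..<p + r})" by simp
  also have "\<dots> \<le> card {m..<m + n}"
  proof (rule card_mono)
    show "(\<Union>p\<in>P. {p..<p + r}) \<subseteq> {m..<m + n}"
      using up m(2) by fastforce
  qed simp
  finally show ?thesis by simp
qed

section \<open>Alternating sets\<close>

text \<open>Each element of \<open>B\<close> comes right after its partner from \<open>A\<close> in
  the chain. This refutes alternations by looking at small elements only.\<close>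

lemma alternates_ex_less:
  assumes "alternates k A B" "finite A" "finite B" "card A = k" "card B = k" "b \<in> B"
  shows "\<exists>a\<in>A. a < b"
proof -
  obtain i where i: "i < k" "sorted_list_of_set B ! i = b"
    using assms by (metis in_set_conv_nth length_sorted_list_of_set set_sorted_list_of_set)
  then have "sorted_list_of_set A ! i < b" using assms(1) by (auto simp: alternates_def)
  moreover have "sorted_list_of_set A ! i \<in> A"
    using assms i by (metis length_sorted_list_of_set nth_mem set_sorted_list_of_set)
  ultimately show ?thesis by blast
qed

lemma alternates_ex_greater:
  assumes "alternates k A B" "finite A" "finite B" "card A = k" "card B = k" "a \<in> A"
  shows "\<exists>b\<in>B. a < b"
proof -
  obtain i where i: "i < k" "sorted_list_of_set A ! i = a"
    using assms by (metis in_set_conv_nth length_sorted_list_of_set set_sorted_list_of_set)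
  then have "a < sorted_list_of_set B ! i" using assms(1) by (auto simp: alternates_def)
  moreover have "sorted_list_of_set B ! i \<in> B"
    using assms i by (metis length_sorted_list_of_set nth_mem set_sorted_list_of_set)
  ultimately show ?thesis by blast
qed

lemma sorted_list_of_set_insert_greater:
  fixes x :: "'a::linorder"
  assumes "finite A" "\<And>a. a \<in> A \<Longrightarrow> a < x"
  shows "sorted_list_of_set (insert x A) = sorted_list_of_set A @ [x]"
proof (rule sorted_distinct_set_unique)
  show "sorted (sorted_list_of_set A @ [x])"
    using assms by (auto simp: sorted_append less_imp_le)
qed (use assms in \<open>auto simp del: sorted_list_of_set_insert_remove\<close>)

lemma sorted_list_of_set_image_mono:
  fixes f :: "'a::linorder \<Rightarrow> 'b::linorder"
  assumes "mono f" "inj_on f A" "finite A"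
  shows "sorted_list_of_set (f ` A) = map f (sorted_list_of_set A)"
proof (rule sorted_distinct_set_unique)
  show "sorted (map f (sorted_list_of_set A))"
    using assms by (simp add: sorted_map_mono mono_on_subset)
qed (use assms in \<open>auto simp: distinct_map\<close>)

text \<open>It carries an alternation of the restrictions to \<open>{1..n - r}\<close> back to the
  whole polygons.\<close>

lemma alternates_insert_greater:
  assumes "alternates k A B" "finite A" "finite B" "card A = k" "card B = k"
    and "\<And>a. a \<in> A \<union> B \<Longrightarrow> a < x" "x < y"
  shows "alternates (Suc k) (insert x A) (insert y B)"
proof -
  have "sorted_list_of_set (insert x A) = sorted_list_of_set A @ [x]"
    using assms by (intro sorted_list_of_set_insert_greater) auto
  moreover have "sorted_list_of_set (insert y B) = sorted_list_of_set B @ [y]"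
    using assms by (intro sorted_list_of_set_insert_greater) (auto intro: less_trans)
  moreover have "sorted_list_of_set B ! i < x" if "i < k" for i
    using that assms by (metis UnI2 length_sorted_list_of_set nth_mem set_sorted_list_of_set)
  ultimately show ?thesis
    using assms(1,4,5,7) by (auto simp: alternates_def nth_append less_Suc_eq)
qed

text \<open>Even a weakly monotone map reflects strict inequalities, so contracting an edge creates
  no new alternation.\<close>

lemma alternates_image_monoD:
  assumes "alternates k (f ` A) (f ` B)" "mono f" "inj_on f A" "inj_on f B"
    and "finite A" "finite B" "card A = k" "card B = k"
  shows "alternates k A B"
proof -
  have "x < y" if "f x < f y" for x y
    using that \<open>mono f\<close> by (meson leD leI monoD)
  then show ?thesis
    using assms by (auto simp: alternates_def sorted_list_of_set_image_mono)
qed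

lemma not_alternates_self: "0 < k \<Longrightarrow> \<not> alternates k P P"
  by (auto simp: alternates_def)

text \<open>Ordered pairs cover both orders in \<open>interlace\<close>. The diagonal, which
  \<open>indep\<close> ignores, is harmless because a nonempty polygon does not alternate with
  itself.\<close>

lemma indep_IG_edges_iff:
  assumes "0 < k" "S \<subseteq> IG_verts n k r"
  shows "indep S (IG_edges n k r) \<longleftrightarrow> (\<forall>P\<in>S. \<forall>Q\<in>S. \<not> alternates k P Q)"
  (is "?L \<longleftrightarrow> ?R")
proof
  assume L: ?L
  show ?R
  proof (intro ballI notI)
    fix P Q assume PQ: "P \<in> S" "Q \<in> S" "alternates k P Q"
    then have "P \<noteq> Q" using not_alternates_self assms(1) by blast
    moreover have "{P, Q} \<in> IG_edges n k r"
      using PQ assms(2) unfolding IG_edges_def interlace_def by blast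
    ultimately show False using L PQ by (auto simp: indep_def)
  qed
next
  assume ?R
  then show ?L
    by (auto simp: indep_def IG_edges_def interlace_def doubleton_eq_iff)
qed

section \<open>The upper bound\<close>

text \<open>Two distinct singletons always alternate in one of the two orders. This is the case
  \<open>k = 1\<close> of the upper bound.\<close>

lemma card_nonalternating_singletons:
  assumes "S \<subseteq> IG_verts n 1 r" "\<And>P Q. P \<in> S \<Longrightarrow> Q \<in> S \<Longrightarrow> \<not> alternates 1 P Q"
  shows "card S \<le> 1"
proof -
  have "P = Q" if PQ: "P \<in> S" "Q \<in> S" for P Q
  proof -
    have "card P = 1" "card Q = 1" using PQ assms(1) by (auto simp: IG_verts_iff)
    then obtain p q where "P = {p}" "Q = {q}" by (metis card_1_singletonE)
    then show ?thesis
      using assms(2)[OF PQ] assms(2)[OF PQ(2,1)] by (auto simp: alternates_def)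
  qed
  moreover have "finite S" using assms(1) finite_IG_verts finite_subset by blast
  ultimately show ?thesis using card_le_Suc0_iff_eq[of S] by simp
qed

text \<open>For a stable polygon: some gap of length exactly \<open>r\<close> contains the edge \<open>{n - 1, n}\<close>.\<close>

definition tight :: "nat \<Rightarrow> nat \<Rightarrow> nat set \<Rightarrow> bool" where
  "tight n r P \<longleftrightarrow> n \<in> P \<and> n - r \<in> P \<or> (\<exists>j\<in>{1..<r}. j \<in> P \<and> n - r + j \<in> P)"

section \<open>Contraction of the edge \<open>{n - 1, n}\<close>\<close>

lemma inj_on_contract:
  assumes "P \<in> IG_verts n k r" "2 \<le> r"
  shows "inj_on (\<lambda>x. min x (n - 1)) P"
proof (rule linorder_inj_onI)
  fix a b assume ab: "a < b" "a \<in> P" "b \<in> P"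
  then have "a + r \<le> b" "b \<le> n" using assms by (auto simp: IG_verts_iff)
  \<comment> \<open>Only \<open>n - 1\<close> and \<open>n\<close> are merged, and their distance 1
    is less than \<open>r\<close>.\<close>
  then show "min a (n - 1) \<noteq> min b (n - 1)" using assms(2) by auto
qed auto

lemma contract_image:
  assumes "P \<in> IG_verts n k r"
  shows "(\<lambda>x. min x (n - 1)) ` P = (if n \<in> P then insert (n - 1) (P - {n}) else P)"
proof -
  have "P \<subseteq> {1..n}" using assms by (simp add: IG_verts_iff)
  then have "(\<lambda>x. min x (n - 1)) ` (P - {n}) = id ` (P - {n})"
    by (intro image_cong refl) fastforce
  then have *: "(\<lambda>x. min x (n - 1)) ` (P - {n}) = P - {n}" by simp
  show ?thesis
  proof (cases "n \<in> P")
    case True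
    then have "(\<lambda>x. min x (n - 1)) ` P
      = insert (min n (n - 1)) ((\<lambda>x. min x (n - 1)) ` (P - {n}))" by blast
    then show ?thesis using * True by simp
  qed (use * in simp)
qed

text \<open>Only arcs across the contracted edge get shorter, and only by one. Stability is lost
  just when such an arc has length exactly \<open>r\<close>, which \<open>tight\<close>
  describes.\<close>

lemma contract_IG_verts:
  assumes P: "P \<in> IG_verts n k r" and "2 \<le> r" "r \<le> n" and nt: "\<not> tight n r P"
  shows "(\<lambda>x. min x (n - 1)) ` P \<in> IG_verts (n - 1) k r"
proof -
  let ?f = "\<lambda>x. min x (n - 1)"
  have sub: "P \<subseteq> {1..n}" and gap: "\<And>a b. a \<in> P \<Longrightarrow> b \<in> P \<Longrightarrow> a < b \<Longrightarrow> a + r \<le> b \<and> b + r \<le> a + n"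
    using P by (auto simp: IG_verts_iff)
  have "card (?f ` P) = k"
    using card_image[OF inj_on_contract[OF P \<open>2 \<le> r\<close>]] P by (simp add: IG_verts_iff)
  moreover have "?f ` P \<subseteq> {1..n - 1}" using sub assms by fastforce
  moreover have "?f a + r \<le> ?f b \<and> ?f b + r \<le> ?f a + (n - 1)"
    if ab: "a \<in> P" "b \<in> P" "?f a < ?f b" for a b
  proof -
    have less: "a < b" using ab(3) by (meson leI min.mono not_le order_refl)
    have g: "a + r \<le> b" "b + r \<le> a + n" using gap[OF ab(1,2) less] by auto
    have bd: "1 \<le> a" "b \<le> n" using sub ab by auto
    show ?thesis
    \<comment> \<open>For \<open>b = n\<close> the arc from \<open>a\<close> up to \<open>b\<close>
      loses one; otherwise the arc from \<open>b\<close> round to \<open>a\<close> does.\<close>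
    proof (cases "b = n")
      case True
      then have "a \<noteq> n - r" using nt ab by (auto simp: tight_def)
      then show ?thesis using True g bd assms(2,3) by auto
    next
      case False
      have "b + r \<noteq> a + n"
      proof
        assume e: "b + r = a + n"
        then have "b = n - r + a" "a < r" using assms(3) bd False by auto
        then show False using nt ab bd by (auto simp: tight_def)
      qed
      then show ?thesis using False g bd assms(2,3) by auto
    qed
  qed
  ultimately show ?thesis unfolding IG_verts_iff by blast
qed

text \<open>A common description, by the greatest element \<open>x\<close>, of the tight polygons and of those
  polygons through \<open>n\<close> whose partner through \<open>n - 1\<close> also lies in the family \<open>S\<close>.\<close>

definition lost :: "nat \<Rightarrow> nat \<Rightarrow> nat set set \<Rightarrow> nat set \<Rightarrow> nat \<Rightarrow> bool" where
  "lost n r S P x \<longleftrightarrow> n - r < x \<and> x \<le> n \<and> P = insert x (P \<inter> {1..n - r}) \<and>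
     (if x = n then n - r \<in> P \<or> insert (n - 1) (P \<inter> {1..n - r}) \<in> S
      else x - (n - r) \<in> P)"

section \<open>Lost polygons and their restriction to \<open>{1..n - r}\<close>\<close>

lemma lost_tight:
  assumes P: "P \<in> IG_verts n k r" and "2 \<le> r" "2 * r \<le> n" and t: "tight n r P"
  shows "\<exists>x. lost n r S P x"
proof -
  have sub: "P \<subseteq> {1..n}" and gap: "\<And>a b. a \<in> P \<Longrightarrow> b \<in> P \<Longrightarrow> a < b \<Longrightarrow> a + r \<le> b \<and> b + r \<le> a + n"
    using P by (auto simp: IG_verts_iff)
  \<comment> \<open>The last \<open>r\<close> positions hold at most one point of a stable polygon,
    so all points other than \<open>x\<close> are at most \<open>n - r\<close>.\<close>
  have eq: "P = insert x (P \<inter> {1..n - r})" if x: "x \<in> P" "n - r < x" for x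
  proof -
    have "y \<le> n - r" if y: "y \<in> P" "y \<noteq> x" for y
    proof -
      have "x \<le> n" "y \<le> n" using x y sub by auto
      then show ?thesis
        using gap[OF x(1) y(1)] gap[OF y(1) x(1)] x(2) y(2) assms(2,3) by (cases "x < y") auto
    qed
    then show ?thesis using x(1) sub by auto
  qed
  from t consider "n \<in> P" "n - r \<in> P" | j where "1 \<le> j" "j < r" "j \<in> P" "n - r + j \<in> P"
    by (auto simp: tight_def)
  then show ?thesis
  proof cases
    case 1
    then have "lost n r S P n" using eq[of n] assms(2,3) by (auto simp: lost_def)
    then show ?thesis by blast
  next
    case 2
    then have "lost n r S P (n - r + j)" using eq[of "n - r + j"] assms(2,3) by (auto simp: lost_def)
    then show ?thesis by blast
  qed
qed

lemma lost_paired: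
  assumes P: "P \<in> IG_verts n k r" and "2 \<le> r" "2 * r \<le> n"
    and "n \<in> P" "insert (n - 1) (P - {n}) \<in> S"
  shows "lost n r S P n"
proof -
  have sub: "P \<subseteq> {1..n}" and gap: "\<And>a b. a \<in> P \<Longrightarrow> b \<in> P \<Longrightarrow> a < b \<Longrightarrow> a + r \<le> b \<and> b + r \<le> a + n"
    using P by (auto simp: IG_verts_iff)
  have "y \<le> n - r" if y: "y \<in> P" "y \<noteq> n" for y
    using gap[OF y(1) \<open>n \<in> P\<close>] y sub by fastforce
  then have "P \<inter> {1..n - r} = P - {n}" using sub assms by auto
  then show ?thesis using assms by (auto simp: lost_def)
qed

text \<open>It identifies the point \<open>x - (n - r)\<close>, which \<open>lost\<close> puts into
  \<open>P\<close> for \<open>x \<noteq> n\<close>, as the only point of \<open>P\<close> in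
  \<open>{1..r}\<close>.\<close>

lemma IG_verts_small_unique:
  assumes "P \<in> IG_verts n k r" "a \<in> P" "b \<in> P" "a \<le> r" "b \<le> r"
  shows "a = b"
proof (rule ccontr)
  assume "a \<noteq> b"
  moreover have "1 \<le> a" "1 \<le> b" using assms by (auto simp: IG_verts_iff)
  moreover have "a < b \<longrightarrow> a + r \<le> b" "b < a \<longrightarrow> b + r \<le> a" using assms by (auto simp: IG_verts_iff)
  ultimately show False using assms(4,5) by linarith
qed

text \<open>The arc from \<open>n\<close> round to \<open>a\<close> has length \<open>a\<close>.
  Hence a point below \<open>r\<close> excludes the branch \<open>x = n\<close> of
  \<open>lost\<close>.\<close>

lemma lost_n_ge:
  assumes "P \<in> IG_verts n k r" "lost n r S P n" "a \<in> P" "r \<le> n"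
  shows "r \<le> a"
proof (cases "a = n")
  case True
  then show ?thesis using assms by (auto simp: lost_def IG_verts_iff)
next
  case False
  have "n \<in> P" using assms(2) by (auto simp: lost_def)
  moreover have "a \<le> n" using assms by (auto simp: IG_verts_iff)
  ultimately have "n + r \<le> a + n" using assms False by (auto simp: IG_verts_iff)
  then show ?thesis by simp
qed


text \<open>The new wraparound condition is \<open>b - a \<le> n - 2 * r\<close>. For
  \<open>x = n\<close> it follows from \<open>r \<le> a\<close> and \<open>b \<le> n - r\<close>.
  Otherwise \<open>j = x - (n - r)\<close> lies in \<open>P\<close>, and \<open>j \<le> a\<close>
  and \<open>b \<le> x - r\<close> give it.\<close>

lemma lost_imp_IG_verts:
  assumes P: "P \<in> IG_verts n (Suc k) r" and "2 \<le> r" "2 * r \<le> n" and l: "lost n r S P x"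
  shows "P \<inter> {1..n - r} \<in> IG_verts (n - r) k r"
proof -
  have sub: "P \<subseteq> {1..n}" and gap: "\<And>a b. a \<in> P \<Longrightarrow> b \<in> P \<Longrightarrow> a < b \<Longrightarrow> a + r \<le> b \<and> b + r \<le> a + n"
    and card: "card P = Suc k"
    using P by (auto simp: IG_verts_iff)
  have x: "n - r < x" "x \<le> n" "P = insert x (P \<inter> {1..n - r})" using l by (auto simp: lost_def)
  then have xP: "x \<in> P" by blast
  have "card (insert x (P \<inter> {1..n - r})) = Suc (card (P \<inter> {1..n - r}))"
    using x(1) by (intro card_insert_disjoint) auto
  then have "card (P \<inter> {1..n - r}) = k" using x(3) card by simp
  moreover have "b + r \<le> a + (n - r)"
    if ab: "a \<in> P \<inter> {1..n - r}" "b \<in> P \<inter> {1..n - r}" "a < b" for a b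
  proof (cases "x = n")
    case True
    then have "r \<le> a" using lost_n_ge[OF P] l ab assms(3) by auto
    moreover have "b + r \<le> n" using ab assms by auto
    ultimately show ?thesis using assms(2,3) gap[of b n] xP True ab by auto
  next
    case False
    define j where "j = x - (n - r)"
    have jP: "j \<in> P" and j: "1 \<le> j" "j < r" "x = n - r + j"
      using l False x(1,2) by (auto simp: lost_def j_def)
    have "j \<le> a"
    proof (rule ccontr)
      assume "\<not> j \<le> a"
      then have "a + r \<le> j" using gap[of a j] jP ab by auto
      then show False using j by simp
    qed
    moreover have "b + r \<le> x" using gap[of b x] xP ab x(1) by auto
    ultimately show ?thesis using j assms(3) by auto
  qed
  ultimately show ?thesis using gap unfolding IG_verts_iff by blast
qed

text \<open>The greatest element can be read off the restriction: it is \<open>n - r + j\<close> if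
  a point \<open>j < r\<close> is present, and \<open>n\<close> if there is none.\<close>

lemma lost_inj:
  assumes P: "P \<in> IG_verts n k r" "lost n r S P x" and Q: "Q \<in> IG_verts n k r" "lost n r S Q y"
    and "2 \<le> r" "2 * r \<le> n" and eq: "P \<inter> {1..n - r} = Q \<inter> {1..n - r}"
  shows "P = Q"
proof -
  have *: "x \<le> y"
    if P: "P \<in> IG_verts n k r" "lost n r S P x" and Q: "Q \<in> IG_verts n k r" "lost n r S Q y"
      and eq: "P \<inter> {1..n - r} = Q \<inter> {1..n - r}" for P Q x y
  proof (cases "y = n")
    case True
    then show ?thesis using P(2) by (simp add: lost_def)
  next
    case False
    define j where "j = y - (n - r)"
    have j: "j \<in> Q" "1 \<le> j" "j < r" "y = n - r + j" using Q(2) False by (auto simp: lost_def j_def)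
    then have "j \<in> Q \<inter> {1..n - r}" using assms(6) by simp
    then have jP: "j \<in> P" unfolding eq[symmetric] by simp
    have "x \<noteq> n" using lost_n_ge[OF P(1) _ jP] P(2) j(3) assms(6) by auto
    then have i: "x - (n - r) \<in> P" "x - (n - r) \<le> r" using P(2) by (auto simp: lost_def)
    then have "x - (n - r) = j" using IG_verts_small_unique[OF P(1) i(1) jP] j(3) by simp
    then show ?thesis using j(4) by simp
  qed
  have "x = y" using *[OF P Q eq] *[OF Q P eq[symmetric]] by simp
  have "P = insert x (P \<inter> {1..n - r})" "Q = insert y (Q \<inter> {1..n - r})"
    using P(2) Q(2) by (simp_all add: lost_def)
  then show ?thesis using \<open>x = y\<close> eq by metis
qed

text \<open>If \<open>x < y\<close>, appending \<open>x\<close> and \<open>y\<close> to the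
  restrictions makes \<open>P\<close> and \<open>Q\<close> alternate. The extra condition in
  \<open>lost\<close> settles the rest: for \<open>y < n\<close> it forces \<open>x < y\<close>, and
  for \<open>x = y = n\<close> it leaves two cases, each contradictory.\<close>

lemma lost_not_alternates:
  assumes S: "S \<subseteq> IG_verts n (Suc k) r" "\<And>P Q. P \<in> S \<Longrightarrow> Q \<in> S \<Longrightarrow> \<not> alternates (Suc k) P Q"
    and P: "P \<in> S" "lost n r S P x" and Q: "Q \<in> S" "lost n r S Q y"
    and "2 \<le> r" "2 * r \<le> n"
  shows "\<not> alternates k (P \<inter> {1..n - r}) (Q \<inter> {1..n - r})" (is "\<not> alternates k ?A ?B")
proof
  assume alt: "alternates k ?A ?B"
  have PV: "P \<in> IG_verts n (Suc k) r" and QV: "Q \<in> IG_verts n (Suc k) r" using P Q S by auto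
  have "?A \<in> IG_verts (n - r) k r" "?B \<in> IG_verts (n - r) k r"
    using lost_imp_IG_verts PV QV P Q assms by blast+
  then have c: "finite ?A" "finite ?B" "card ?A = k" "card ?B = k" by (auto simp: IG_verts_iff)
  have eqs: "P = insert x ?A" "Q = insert y ?B" and xy: "n - r < x" "x \<le> n" "n - r < y" "y \<le> n"
    using P Q by (auto simp: lost_def)
  have ext: "alternates (Suc k) (insert u ?A) (insert v ?B)" if "n - r < u" "u < v" for u v
    using that by (intro alternates_insert_greater[OF alt c]) auto
  have "\<not> x < y" using ext[of x y] S(2)[OF P(1) Q(1)] eqs xy by metis
  show False
  proof (cases "y = n")
    case True
    then have "x = n" using \<open>\<not> x < y\<close> xy by simp
    then consider "n - r \<in> P" | "insert (n - 1) ?A \<in> S" using P(2) by (auto simp: lost_def)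
    then show False
    proof cases
      case 1
      then have "n - r \<in> ?A" using assms by auto
      then obtain b where "b \<in> ?B" "n - r < b" using alternates_ex_greater[OF alt c] by blast
      then show False by auto
    next
      case 2
      \<comment> \<open>\<open>P\<close> and \<open>Q\<close> share the point \<open>n\<close>, but
        the partner of \<open>P\<close> ends in \<open>n - 1\<close>, below
        \<open>y = n\<close>.\<close>
      have "alternates (Suc k) (insert (n - 1) ?A) (insert y ?B)"
        using True assms by (intro ext) auto
      then show False using S(2)[OF 2 Q(1)] eqs(2) by simp
    qed
  next
    case False
    define j where "j = y - (n - r)"
    have j: "j \<in> Q" "1 \<le> j" "j < r" "y = n - r + j" using Q(2) False by (auto simp: lost_def j_def)
    then have "j \<in> ?B" using assms by auto
    \<comment> \<open>The point \<open>a\<close> of \<open>P\<close> below \<open>r\<close>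
      determines \<open>x = n - r + a\<close>, which is less than
      \<open>n - r + j = y\<close>.\<close>
    then obtain a where a: "a \<in> ?A" "a < j" using alternates_ex_less[OF alt c] by blast
    then have aP: "a \<in> P" by simp
    have "x \<noteq> n" using lost_n_ge[OF PV _ aP] P(2) a j(3) assms by auto
    then have i: "x - (n - r) \<in> P" "x - (n - r) \<le> r" using P(2) by (auto simp: lost_def)
    then have "x - (n - r) = a" using IG_verts_small_unique[OF PV i(1) aP] a j(3) by simp
    then show False using \<open>\<not> x < y\<close> a j(4) xy by simp
  qed
qed

section \<open>The induction on \<open>n\<close>\<close>

text \<open>The bound covers every \<open>n\<close> because the induction passes to
  \<open>n - 1\<close>, which may fall below \<open>r * k\<close>. There \<open>IG_verts_le\<close>
  leaves only the empty family for \<open>2 \<le> k\<close>, and the case \<open>k = 1\<close> is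
  treated directly.\<close>

lemma card_nonalternating_le:
  assumes "2 \<le> r" "0 < k" "S \<subseteq> IG_verts n k r"
    and "\<And>P Q. P \<in> S \<Longrightarrow> Q \<in> S \<Longrightarrow> \<not> alternates k P Q"
  shows "card S \<le> (n - (r - 1) * k - 1) choose (k - 1)"
  using assms(2-4)
proof (induction n arbitrary: k S rule: less_induct)
  case (less n)
  note S = less.prems(2) and na = less.prems(3)
  have finS: "finite S" using S finite_IG_verts finite_subset by blast
  consider "k = 1" | "2 \<le> k" "S = {}" | "2 \<le> k" "S \<noteq> {}" using less.prems(1) by linarith
  then show ?case
  proof cases
    case 1
    then show ?thesis using card_nonalternating_singletons[of S n r] S na by simp
  next
    case 2
    then show ?thesis by simp
  next
    case 3
    then have rk: "r * k \<le> n" using IG_verts_le S by blast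
    have "r * 2 \<le> r * k" using 3 by (intro mult_le_mono2)
    then have r2: "2 * r \<le> n" using rk by linarith
    obtain k' where k': "k = Suc k'" "0 < k'" using 3 by (cases k) auto
    let ?f = "\<lambda>x. min x (n - 1)"
    define D where "D = {P \<in> S. tight n r P \<or> n \<in> P \<and> insert (n - 1) (P - {n}) \<in> S}"
    have DS: "D \<subseteq> S" by (auto simp: D_def)

    \<comment> \<open>Distinct polygons with equal contractions have the form
      \<open>A \<union> {n}\<close> and \<open>A \<union> {n - 1}\<close>; if both are in
      \<open>S\<close>, the one through \<open>n\<close> is in \<open>D\<close>.\<close>
    have injf: "inj_on ((`) ?f) (S - D)"
    proof (rule inj_onI)
      fix P Q assume PQ: "P \<in> S - D" "Q \<in> S - D" "?f ` P = ?f ` Q"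
      then have V: "P \<in> IG_verts n k r" "Q \<in> IG_verts n k r" using S by auto
      note eqs = contract_image[OF V(1)] contract_image[OF V(2)]
      consider "n \<in> P" "n \<in> Q" | "n \<in> P" "n \<notin> Q" | "n \<notin> P" "n \<in> Q" | "n \<notin> P" "n \<notin> Q" by blast
      then show "P = Q"
      proof cases
        case 1
        have *: "n - 1 \<notin> R - {n}" if R: "R \<in> IG_verts n k r" "n \<in> R" for R
        proof
          assume "n - 1 \<in> R - {n}"
          then have "n - 1 = n" using R assms(1) r2 by (fastforce simp: IG_verts_iff)
          then show False using assms(1) r2 by simp
        qed
        have "insert (n - 1) (P - {n}) = insert (n - 1) (Q - {n})" using PQ(3) eqs 1 by simp
        then have "P - {n} = Q - {n}" using *[OF V(1) 1(1)] *[OF V(2) 1(2)] insert_ident by metis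
        then show ?thesis using 1 by blast
      next
        case 2
        then have "insert (n - 1) (P - {n}) = Q" using PQ(3) eqs by simp
        then show ?thesis using PQ 2 unfolding D_def by blast
      next
        case 3
        then have "insert (n - 1) (Q - {n}) = P" using PQ(3) eqs by simp
        then show ?thesis using PQ 3 unfolding D_def by blast
      next
        case 4
        then show ?thesis using PQ(3) eqs by simp
      qed
    qed

    have "card ((`) ?f ` (S - D)) \<le> (n - 1 - (r - 1) * k - 1) choose (k - 1)"
    proof (rule less.IH)
      show "n - 1 < n" using r2 assms(1) by simp
      show "0 < k" using k' by simp
      show "(`) ?f ` (S - D) \<subseteq> IG_verts (n - 1) k r"
      proof (rule image_subsetI)
        fix P assume "P \<in> S - D"
        then show "?f ` P \<in> IG_verts (n - 1) k r"
          using S assms(1) r2 by (intro contract_IG_verts) (auto simp: D_def)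
      qed
      fix P' Q' assume "P' \<in> (`) ?f ` (S - D)" "Q' \<in> (`) ?f ` (S - D)"
      then obtain P Q where PQ: "P \<in> S" "Q \<in> S" "P' = ?f ` P" "Q' = ?f ` Q" by blast
      then have V: "P \<in> IG_verts n k r" "Q \<in> IG_verts n k r" using S by auto
      show "\<not> alternates k P' Q'"
      proof
        assume "alternates k P' Q'"
        then have "alternates k P Q"
          unfolding PQ(3,4)
          by (rule alternates_image_monoD)
            (use V inj_on_contract assms(1) IG_verts_finite in \<open>auto simp: IG_verts_iff mono_def\<close>)
        then show False using na PQ by blast
      qed
    qed
    then have contracted: "card (S - D) \<le> (n - 1 - (r - 1) * k - 1) choose (k - 1)"
      using card_image[OF injf] by simp

    have lost: "\<exists>x. lost n r S P x" if "P \<in> D" for P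
      using that S lost_tight[of P n k r S] lost_paired[of P n k r S] assms(1) r2
      unfolding D_def by blast
    have "inj_on (\<lambda>P. P \<inter> {1..n - r}) D"
    proof (rule inj_onI)
      fix P Q assume PQ: "P \<in> D" "Q \<in> D" and eq: "P \<inter> {1..n - r} = Q \<inter> {1..n - r}"
      have V: "P \<in> IG_verts n k r" "Q \<in> IG_verts n k r" using PQ DS S by auto
      obtain x y where xy: "lost n r S P x" "lost n r S Q y" using lost PQ by blast
      show "P = Q" by (rule lost_inj[OF V(1) xy(1) V(2) xy(2) assms(1) r2 eq])
    qed
    moreover have "card ((\<lambda>P. P \<inter> {1..n - r}) ` D) \<le> (n - r - (r - 1) * k' - 1) choose (k' - 1)"
    proof (rule less.IH)
      show "n - r < n" using r2 assms(1) by simp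
      show "0 < k'" by fact
      show "(\<lambda>P. P \<inter> {1..n - r}) ` D \<subseteq> IG_verts (n - r) k' r"
      proof (rule image_subsetI)
        fix P assume "P \<in> D"
        moreover from this obtain x where x: "lost n r S P x" using lost by blast
        ultimately have "P \<in> IG_verts n (Suc k') r" using DS S k'(1) by auto
        then show "P \<inter> {1..n - r} \<in> IG_verts (n - r) k' r"
          by (rule lost_imp_IG_verts[OF _ assms(1) r2 x])
      qed
      fix A B assume "A \<in> (\<lambda>P. P \<inter> {1..n - r}) ` D" "B \<in> (\<lambda>P. P \<inter> {1..n - r}) ` D"
      then obtain P Q where PQ: "P \<in> D" "Q \<in> D" "A = P \<inter> {1..n - r}" "B = Q \<inter> {1..n - r}" by blast
      then obtain x y where xy: "lost n r S P x" "lost n r S Q y" using lost by blast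
      have "P \<in> S" "Q \<in> S" using PQ DS by auto
      then show "\<not> alternates k' A B"
        unfolding PQ(3,4)
        using lost_not_alternates[OF S[unfolded k'(1)] na[unfolded k'(1)] _ xy(1) _ xy(2) assms(1) r2]
        by simp
    qed
    ultimately have remaining: "card D \<le> (n - r - (r - 1) * k' - 1) choose (k' - 1)"
      by (simp add: card_image)

    obtain m where m: "k' = Suc m" using k' by (cases k') auto
    obtain q where q: "r = Suc q" using assms(1) by (cases r) auto
    \<comment> \<open>Both \<open>(n - 1, k)\<close> and \<open>(n - r, k - 1)\<close> lower
      \<open>n - (r - 1) * k\<close> by exactly one, so both binomials have upper index
      \<open>N\<close>. Nothing truncates, since
      \<open>n - (r - 1) * k \<ge> k \<ge> 2\<close>.\<close>
    define N where "N = n - (r - 1) * k - 2"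
    have "q * k + k \<le> n" using rk q by simp
    then have N: "n - (r - 1) * k - 1 = Suc N" "n - 1 - (r - 1) * k - 1 = N"
      "n - r - (r - 1) * k' - 1 = N"
      using 3 q k' by (auto simp: N_def)
    have "card (S - D) \<le> N choose Suc m" "card D \<le> N choose m"
      using contracted remaining unfolding N by (simp_all add: k'(1) m)
    then have "card (S - D) + card D \<le> (n - (r - 1) * k - 1) choose (k - 1)"
      unfolding N by (simp add: k'(1) m)
    moreover have "card S = card (S - D) + card D"
      using DS finS by (metis card_Diff_subset card_mono finite_subset le_add_diff_inverse2)
    ultimately show ?thesis by simp
  qed
qed

section \<open>The polygons through a point\<close>

text \<open>A linear version of stability with no condition across the ends: it describes the
  remaining points once the circle is cut at a fixed point of the polygon.\<close>

definition separated_sets :: "nat \<Rightarrow> nat \<Rightarrow> nat \<Rightarrow> nat set set" where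
  "separated_sets r m j = {T. T \<subseteq> {..<m} \<and> card T = j \<and> (\<forall>a\<in>T. \<forall>b\<in>T. a < b \<longrightarrow> a + r \<le> b)}"

lemma finite_separated_sets: "finite (separated_sets r m j)"
  by (rule finite_subset[of _ "Pow {..<m}"]) (auto simp: separated_sets_def)

text \<open>Pascal's rule, according to whether the last position \<open>p = m - 1\<close> is used;
  if so, the other points lie below \<open>Suc p - r\<close>.\<close>

lemma binomial_le_card_separated_sets:
  assumes "0 < r"
  shows "(m + (r - 1) - (r - 1) * j) choose j \<le> card (separated_sets r m j)"
proof (induction m arbitrary: j rule: less_induct)
  case (less m)
  show ?case
  proof (cases j)
    case 0
    have "separated_sets r m 0 = {{}}"
      by (auto simp: separated_sets_def dest: finite_subset)
    then show ?thesis using 0 by simp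
  next
    case (Suc i)
    show ?thesis
    proof (cases m)
      case 0
      then show ?thesis using Suc by simp
    next
      case m: (Suc p)
      show ?thesis
      \<comment> \<open>If this fails, the upper index truncates to 0 while \<open>j\<close> is
        positive, so the binomial vanishes.\<close>
      proof (cases "(r - 1) * i \<le> p")
        case False
        then show ?thesis using Suc m by simp
      next
        case True
        let ?X = "separated_sets r p j" and ?Y = "separated_sets r (Suc p - r) i"
        have Y: "(p - (r - 1) * i) choose i \<le> card ?Y"
        proof (cases "r \<le> Suc p")
          case True
          then have "Suc p - r + (r - 1) = p" using assms by simp
          then show ?thesis using less.IH[of "Suc p - r" i] m assms by simp
        next
          case False
          \<comment> \<open>Here \<open>Suc p - r\<close> truncates to 0, and
            \<open>p < r - 1\<close> leaves only \<open>i = 0\<close>, where the binomial is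
            1.\<close>
          then have "i = 0" using \<open>(r - 1) * i \<le> p\<close> by (cases i) auto
          then show ?thesis using less.IH[of "Suc p - r" 0] m assms by simp
        qed
        have below: "t < Suc p - r" if "T \<in> ?Y" "t \<in> T" for T t
          using that by (auto simp: separated_sets_def)
        have "inj_on (insert p) ?Y"
        proof (rule inj_onI)
          fix T U assume "T \<in> ?Y" "U \<in> ?Y" "insert p T = insert p U"
          moreover from this have "p \<notin> T" "p \<notin> U" using below assms by fastforce+
          ultimately show "T = U" by (simp add: insert_ident)
        qed
        moreover have "?X \<inter> insert p ` ?Y = {}" by (auto simp: separated_sets_def)
        ultimately have "card ?X + card ?Y = card (?X \<union> insert p ` ?Y)"
          by (simp add: card_Un_disjoint card_image finite_separated_sets)
        also have "\<dots> \<le> card (separated_sets r m j)"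
        proof (rule card_mono[OF finite_separated_sets], rule Un_least)
          show "?X \<subseteq> separated_sets r m j" using m by (auto simp: separated_sets_def)
          show "insert p ` ?Y \<subseteq> separated_sets r m j"
          proof (rule image_subsetI)
            fix T assume T: "T \<in> ?Y"
            then have fin: "finite T" by (auto simp: separated_sets_def intro: finite_subset)
            have "p \<notin> T" using below[OF T] assms by fastforce
            then have "card (insert p T) = j" using T fin Suc by (simp add: separated_sets_def)
            moreover have "t + r \<le> p" if "t \<in> T" for t using below[OF T that] by simp
            ultimately show "insert p T \<in> separated_sets r m j"
              using T m by (fastforce simp: separated_sets_def)
          qed
        qed
        finally have "card ?X + card ?Y \<le> card (separated_sets r m j)" .
        moreover have "(p - (r - 1) * i) choose j \<le> card ?X"
          using less.IH[of p j] m Suc by simp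
        moreover have "m + (r - 1) - (r - 1) * j = Suc (p - (r - 1) * i)"
          using True m Suc by simp
        ultimately show ?thesis using Y Suc by simp
      qed
    qed
  qed
qed

text \<open>Besides 1, such a polygon consists of separated points in
  \<open>{r + 1..n + 1 - r}\<close>. This segment has \<open>n + 1 - 2 * r\<close> positions, and
  \<open>h\<close> shifts \<open>{..<Suc n - 2 * r}\<close> onto it.\<close>

lemma binomial_le_card_IG_verts_through_1:
  assumes "0 < k" "2 \<le> r" "r * k \<le> n"
  shows "(n - (r - 1) * k - 1) choose (k - 1) \<le> card {P \<in> IG_verts n k r. 1 \<in> P}"
proof -
  let ?Y = "separated_sets r (Suc n - 2 * r) (k - 1)"
  define h where "h T = insert 1 ((\<lambda>t. t + Suc r) ` T)" for T
  have "inj_on h ?Y"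
  proof (rule inj_onI)
    fix T U assume "h T = h U"
    then have "(\<lambda>t. t + Suc r) ` T = (\<lambda>t. t + Suc r) ` U"
      unfolding h_def using assms(2) by (subst (asm) insert_ident) auto
    moreover have "inj (\<lambda>t. t + Suc r)" by (simp add: inj_on_def)
    ultimately show "T = U" by (metis inj_image_eq_iff)
  qed
  moreover have "h ` ?Y \<subseteq> {P \<in> IG_verts n k r. 1 \<in> P}"
  proof (rule image_subsetI)
    fix T assume T: "T \<in> ?Y"
    then have fin: "finite T" by (auto simp: separated_sets_def intro: finite_subset)
    have bd: "t + 2 * r \<le> n" if "t \<in> T" for t using T that by (auto simp: separated_sets_def)
    have gap: "a + r \<le> b" if "a \<in> T" "b \<in> T" "a < b" for a b
      using T that by (auto simp: separated_sets_def)
    have "card ((\<lambda>t. t + Suc r) ` T) = k - 1"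
      using T by (subst card_image) (auto simp: separated_sets_def inj_on_def)
    then have "card (h T) = k" unfolding h_def using fin assms(1,2) by (subst card_insert_disjoint) auto
    moreover have "1 \<le> n" using assms by (cases n) auto
    then have "h T \<subseteq> {1..n}" using bd assms(2) by (fastforce simp: h_def)
    moreover have "a + r \<le> b \<and> b + r \<le> a + n" if ab: "a \<in> h T" "b \<in> h T" "a < b" for a b
    proof -
      have "1 \<le> a" using ab(1) by (auto simp: h_def)
      then obtain t where t: "t \<in> T" "b = t + Suc r" using ab(2,3) by (auto simp: h_def)
      consider "a = 1" | s where "s \<in> T" "a = s + Suc r" using ab(1) by (auto simp: h_def)
      then show ?thesis
      proof cases
        case 1
        then show ?thesis using t bd[OF t(1)] by simp
      next
        case 2
        then show ?thesis using t bd[OF t(1)] gap[OF 2(1) t(1)] ab(3) by simp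
      qed
    qed
    ultimately show "h T \<in> {P \<in> IG_verts n k r. 1 \<in> P}"
      by (auto simp: IG_verts_iff h_def)
  qed
  ultimately have "card ?Y \<le> card {P \<in> IG_verts n k r. 1 \<in> P}"
    by (intro card_inj_on_le) (simp_all add: finite_IG_verts)
  moreover have "(n - (r - 1) * k - 1) choose (k - 1) \<le> card ?Y"
  \<comment> \<open>For \<open>k = 1\<close>, \<open>n\<close> may be below
    \<open>2 * r - 1\<close>, so that \<open>Suc n - 2 * r\<close> truncates. The binomial is then 1
    and the empty set suffices.\<close>
  proof (cases "k = 1")
    case True
    then show ?thesis
      using binomial_le_card_separated_sets[of r "Suc n - 2 * r" 0] assms by simp
  next
    case False
    then obtain i where i: "k = Suc (Suc i)" using assms(1) by (metis One_nat_def not0_implies_Suc less_numeral_extra(3))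
    obtain q where q: "r = Suc q" using assms(2) by (cases r) auto
    have "Suc n - 2 * r + (r - 1) - (r - 1) * (k - 1) = n - (r - 1) * k - 1"
      using assms(3) by (simp add: i q)
    then show ?thesis
      using binomial_le_card_separated_sets[of r "Suc n - 2 * r" "k - 1"] assms by simp
  qed
  ultimately show ?thesis by simp
qed

theorem theorem3:
  fixes n k r :: nat
  assumes "0 < n" and "0 < k" and "2 \<le> r" and "r * k \<le> n"
  shows "independence_number (IG_verts n k r) (IG_edges n k r)
           = (n - (r - 1) * k - 1) choose (k - 1)"
proof -
  let ?V = "IG_verts n k r" and ?E = "IG_edges n k r"
  let ?C = "(n - (r - 1) * k - 1) choose (k - 1)"
  have upper: "card S \<le> ?C" if "S \<subseteq> ?V" "indep S ?E" for S
    using card_nonalternating_le[OF assms(3,2) that(1)] that indep_IG_edges_iff[OF assms(2) that(1)]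
    by blast
  let ?S = "{P \<in> ?V. 1 \<in> P}"
  have "\<not> alternates k P Q" if PQ: "P \<in> ?S" "Q \<in> ?S" for P Q
  proof
    assume "alternates k P Q"
    \<comment> \<open>The point 1 of \<open>Q\<close> would need a point of \<open>P\<close> below
      it.\<close>
    then have "\<exists>a\<in>P. a < 1"
      by (rule alternates_ex_less) (use PQ IG_verts_finite in \<open>auto simp: IG_verts_iff\<close>)
    then show False using PQ by (auto simp: IG_verts_iff)
  qed
  then have S: "?S \<subseteq> ?V" "indep ?S ?E" using indep_IG_edges_iff[of k ?S n r] assms(2) by auto
  then have "card ?S = ?C"
    using upper binomial_le_card_IG_verts_through_1[OF assms(2-4)] by (simp add: le_antisym)
  then have mem: "?C \<in> {card S | S. S \<subseteq> ?V \<and> indep S ?E}"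
    by (intro CollectI exI[of _ ?S] conjI S) simp
  have "{card S | S. S \<subseteq> ?V \<and> indep S ?E} \<subseteq> {..?C}"
    using upper by blast
  then show ?thesis
    unfolding independence_number_def using mem
    by (intro Max_eqI) (auto intro: finite_subset[OF _ finite_atMost])
qed

end
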